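(* Let $n\ge 0$ be an integer and $T_n=\frac{1}{n+1}\binom{3n+1}{n}$. Then $T_n$ is odd if and only if $n$ is even and the binary expansion of $n$ contains no two consecutive $1$'s. Equivalently, $T_n$ is odd if and only if $n$ is an even Fibbinary integer.
   Context: The numbers $T_n=R_{3,2}(n)=\frac{1}{n+1}\binom{3n+1}{n}$, $n\ge 0$, are the $(3,2)$-Raney numbers; they are integers ($1,2,7,30,143,728,\ldots$). A Fibbinary number is a nonnegative integer whose binary expansion contains no two consecutive $1$'s. *)

theory Defs
  imports Complex_Main
begin

text \<open>The \<open>(3,2)\<close>-Raney numbers. The natural-number division is exact, see
  \<open>Suc_dvd_binomial\<close> and \<open>raney32_eq\<close> below.\<close>

definition raney32 :: "nat \<Rightarrow> nat" where
  "raney32 n = ((3 * n + 1) choose n) div (n + 1)"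

lemma Suc_dvd_binomial: "(n + 1) dvd ((3 * n + 1) choose n)"
proof -
  have "Suc n * ((3 * n + 1) choose Suc n) = (3 * n + 1 - n) * ((3 * n + 1) choose n)"
    by (simp only: binomial_absorption binomial_absorb_comp)
  moreover have "3 * n + 1 - n = 2 * n + 1"
    by simp
  ultimately have "Suc n dvd (2 * n + 1) * ((3 * n + 1) choose n)"
    by (metis dvd_triv_left)
  moreover have "coprime (Suc n) (2 * n + 1)"
    by (metis Suc_eq_plus1 add_Suc_right add_Suc_shift coprime_Suc_left_nat
        coprime_mult_left_iff mult_2)
  ultimately show ?thesis
    by (metis Suc_eq_plus1 coprime_dvd_mult_right_iff)
qed

lemma raney32_eq: "real (raney32 n) = 1 / (real n + 1) * real ((3 * n + 1) choose n)"
  using Suc_dvd_binomial [of n] by (simp add: raney32_def real_of_nat_div add.commute)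

text \<open>\<open>bit n i\<close> is the digit of weight \<open>2 ^ i\<close> in the binary expansion of \<open>n\<close>.\<close>

definition fibbinary :: "nat \<Rightarrow> bool" where
  "fibbinary n \<longleftrightarrow> (\<nexists>i. bit n i \<and> bit n (i + 1))"

end

theory Submission
  imports Defs
begin

text \<open>
  Since \<open>(n + 1) * C(3 n + 1, n + 1) = (2 n + 1) * C(3 n + 1, n)\<close>, the number
  \<open>C(3 n + 1, n + 1)\<close> is \<open>(2 n + 1) * T\<^sub>n\<close> and hence has the parity of \<open>T\<^sub>n\<close>. By Kummer's
  theorem for the prime 2, it is odd iff \<open>2 n\<close> and \<open>n + 1\<close> have no binary digit 1 in common.
  For even \<open>n\<close> this says that \<open>n\<close> is Fibbinary; for odd \<open>n\<close>, the lowest digit 1 of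
  \<open>n + 1\<close> is always shared.
\<close>

lemma even_binomial_even_odd: "even ((2 * m) choose (2 * k + 1))"
proof -
  have "(2 * k + 1) * ((2 * m) choose (2 * k + 1)) = 2 * m * ((2 * m - 1) choose (2 * k))"
    using binomial_absorption [of "2 * k" "2 * m"] by simp
  then have "even ((2 * k + 1) * ((2 * m) choose (2 * k + 1)))"
    by simp
  then show ?thesis
    by simp
qed

text \<open>Two Pascal steps give C(2m+2, 2l+2) = C(2m, 2l) + 2 C(2m, 2l+1) + C(2m, 2l+2). Modulo 2
  this is Pascal's rule for the halved indices.\<close>

lemma even_binomial_double: "even ((2 * m) choose (2 * k)) \<longleftrightarrow> even (m choose k)"
proof (induction m arbitrary: k)
  case 0
  then show ?case by (cases k) auto
next
  case (Suc m)
  show ?case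
  proof (cases k)
    case (Suc l)
    then show ?thesis
      using Suc.IH [of l] Suc.IH [of k] even_binomial_even_odd [of m l] by simp
  qed simp
qed

text \<open>One Pascal step leads to row \<open>2 * m\<close>, where the summand with odd lower
  index is even.\<close>

lemma even_binomial_Suc_double:
  "even ((2 * m + 1) choose (2 * k)) \<longleftrightarrow> even (m choose k)"
  "even ((2 * m + 1) choose (2 * k + 1)) \<longleftrightarrow> even (m choose k)"
proof -
  show "even ((2 * m + 1) choose (2 * k + 1)) \<longleftrightarrow> even (m choose k)"
    using even_binomial_even_odd [of m k] even_binomial_double [of m k] by simp
  show "even ((2 * m + 1) choose (2 * k)) \<longleftrightarrow> even (m choose k)"
  proof (cases k)
    case (Suc l)
    then show ?thesis
      using even_binomial_even_odd [of m l] even_binomial_double [of m k] by simp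
  qed simp
qed

text \<open>Kummer's theorem for the prime 2, by stripping the lowest binary digit of
  \<open>a\<close> and \<open>b\<close> simultaneously.\<close>

lemma odd_binomial_iff_and_eq_0:
  fixes a b :: nat
  shows "odd ((a + b) choose b) \<longleftrightarrow> and a b = 0"
proof (induction a arbitrary: b rule: less_induct)
  case (less a)
  show ?case
  proof (cases "a = 0")
    case False
    define a' b' where "a' = a div 2" and "b' = b div 2"
    have IH: "odd ((a' + b') choose b') \<longleftrightarrow> and a' b' = 0"
      using less.IH [of a' b'] False by (simp add: a'_def)
    have rec: "and a b = of_bool (odd a \<and> odd b) + 2 * and a' b'"
      by (simp add: and_rec [of a b] a'_def b'_def)
    consider "a = 2 * a'" "b = 2 * b'" | "a = 2 * a'" "b = 2 * b' + 1"
      | "a = 2 * a' + 1" "b = 2 * b'" | "a = 2 * a' + 1" "b = 2 * b' + 1"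
      unfolding a'_def b'_def by (metis evenE oddE even_two_times_div_two odd_two_times_div_two_succ)
    then show ?thesis
    proof cases
      case 1
      then show ?thesis
        using IH rec even_binomial_double [of "a' + b'" b'] by (simp add: algebra_simps)
    next
      case 2
      then show ?thesis
        using IH rec even_binomial_Suc_double(2) [of "a' + b'" b']
        by (simp add: algebra_simps del: binomial_Suc_Suc)
    next
      case 3
      then show ?thesis
        using IH rec even_binomial_Suc_double(1) [of "a' + b'" b'] by (simp add: algebra_simps)
    next
      \<comment> \<open>Two lowest digits 1 produce a carry: the upper index is
        \<open>2 * (a' + b' + 1)\<close> and the lower one is odd, so the coefficient is even
        without the induction hypothesis.\<close>
      case 4
      then show ?thesis
        using rec even_binomial_even_odd [of "a' + b' + 1" b']
        by (simp add: algebra_simps del: binomial_Suc_Suc)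
    qed
  qed simp
qed

text \<open>This trades the divisor \<open>n + 1\<close>, which may be even, for an odd
  factor.\<close>

lemma binomial_eq_raney32: "(3 * n + 1) choose (n + 1) = (2 * n + 1) * raney32 n"
proof -
  have "Suc n * ((3 * n + 1) choose Suc n) = (3 * n + 1 - n) * ((3 * n + 1) choose n)"
    by (simp only: binomial_absorption binomial_absorb_comp)
  also have "\<dots> = (2 * n + 1) * (Suc n * raney32 n)"
  proof -
    have "Suc n * raney32 n = (3 * n + 1) choose n"
      unfolding raney32_def using Suc_dvd_binomial [of n] by (metis Suc_eq_plus1 dvd_mult_div_cancel)
    moreover have "3 * n + 1 - n = 2 * n + 1"
      by simp
    ultimately show ?thesis
      by (simp only:)
  qed
  also have "\<dots> = Suc n * ((2 * n + 1) * raney32 n)"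
    by (simp only: mult.left_commute)
  finally show ?thesis
    by (simp only: mult_cancel1 Suc_eq_plus1 [symmetric]) simp
qed

lemma odd_raney32_iff_and: "odd (raney32 n) \<longleftrightarrow> and (2 * n) (n + 1) = 0"
proof -
  have "odd (raney32 n) \<longleftrightarrow> odd ((3 * n + 1) choose (n + 1))"
    by (simp only: binomial_eq_raney32) simp
  also have "3 * n + 1 = 2 * n + (n + 1)"
    by simp
  finally show ?thesis
    by (simp only: odd_binomial_iff_and_eq_0)
qed

lemma and_double_nat: "and (2 * a) b = 2 * and a (b div 2)" for a b :: nat
  by (simp add: and_rec [of "2 * a" b])

text \<open>If the lowest 1 of \<open>k + 1\<close> is at position t, then 2(k+1) - 1 has digit 1 at
  all positions 0 to t, so position t is shared. The induction removes the trailing zeros of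
  \<open>k + 1\<close>.\<close>

lemma and_Suc_double_Suc_neq_0:
  fixes k :: nat
  shows "and (2 * k + 1) (k + 1) \<noteq> 0"
proof (induction k rule: less_induct)
  case (less k)
  show ?case
  proof (cases "even k")
    case True
    then have "odd (and (2 * k + 1) (k + 1))"
      by (simp add: even_and_iff)
    then show ?thesis
      by (metis even_zero)
  next
    case False
    then obtain j where j: "k = 2 * j + 1"
      by (rule oddE)
    have "and (2 * k + 1) (k + 1) = 2 * and (2 * j + 1) (j + 1)"
      using and_double_nat [of "j + 1" "2 * k + 1"] by (simp add: j and.commute)
    then show ?thesis
      using less.IH [of j] j by simp
  qed
qed

text \<open>Doubling shifts the digits by one place, so a shared 1 is a pair of adjacent 1's in
  \<open>m\<close>.\<close>

lemma and_double_eq_0_iff_fibbinary: "and (2 * m) m = 0 \<longleftrightarrow> fibbinary m"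
proof -
  have "and (2 * m) m = 0 \<longleftrightarrow> (\<forall>i. \<not> (bit (2 * m) i \<and> bit m i))"
    by (simp add: bit_eq_iff bit_and_iff)
  also have "\<dots> \<longleftrightarrow> (\<forall>i. \<not> (bit (2 * m) (Suc i) \<and> bit m (Suc i)))"
    by (metis bit_0 even_mult_iff even_numeral not0_implies_Suc)
  also have "\<dots> \<longleftrightarrow> fibbinary m"
    by (simp add: fibbinary_def bit_Suc [of "2 * m"])
  finally show ?thesis .
qed

lemma fibbinary_double: "fibbinary (2 * m) \<longleftrightarrow> fibbinary m"
proof -
  have "and (2 * (2 * m)) (2 * m) = 2 * and (2 * m) m"
    using and_double_nat [of "2 * m" "2 * m"] by simp
  then show ?thesis
    by (simp flip: and_double_eq_0_iff_fibbinary)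
qed

theorem theorem3p1:
  fixes n :: nat
  shows "(odd (raney32 n) \<longleftrightarrow> even n \<and> (\<nexists>i. bit n i \<and> bit n (i + 1))) \<and>
         (odd (raney32 n) \<longleftrightarrow> even n \<and> fibbinary n)"
proof -
  have "and (2 * n) (n + 1) = 0 \<longleftrightarrow> even n \<and> fibbinary n"
  proof (cases "even n")
    case True
    then obtain m where m: "n = 2 * m"
      by (rule evenE)
    \<comment> \<open>The summand 1 in \<open>n + 1\<close> only fills position 0, where
      \<open>2 * n\<close> has digit 0.\<close>
    have "and (2 * n) (n + 1) = 2 * and (2 * m) m"
      using and_double_nat [of n "n + 1"] by (simp add: m)
    then show ?thesis
      by (simp add: m fibbinary_double and_double_eq_0_iff_fibbinary)
  next
    case False
    then obtain k where k: "n = 2 * k + 1"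
      by (rule oddE)
    have "and (2 * n) (n + 1) = 2 * and (2 * k + 1) (k + 1)"
      using and_double_nat [of n "n + 1"] by (simp add: k)
    then show ?thesis
      using False and_Suc_double_Suc_neq_0 [of k] by simp
  qed
  then show ?thesis
    by (simp add: odd_raney32_iff_and fibbinary_def)
qed

end
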